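(* Let $n, k \in \mathbb{N}^+$ with $\frac{n}{2} < k < n$. Then $$B_{n,k} = (n-k+3)\,2^{n-k-2}.$$
   Context: For $n,k\in\mathbb{N}^+$, $B_{n,k}$ denotes the number of ways to split $n$ indistinguishable balls into any number of nonempty, ordered (linearly arranged) bins so that the most crowded bin contains exactly $k$ balls; equivalently, the number of compositions $(x_1,\dots,x_\ell)$ of $n$ (ordered tuples of positive integers of any length $\ell\ge 1$ summing to $n$) with $\max_i x_i = k$. *)

theory Defs
  imports Complex_Main
begin

definition compositions :: "nat \<Rightarrow> nat list set" where
  "compositions n = {xs. xs \<noteq> [] \<and> (\<forall>x\<in>set xs. 0 < x) \<and> sum_list xs = n}"

definition B :: "nat \<Rightarrow> nat \<Rightarrow> nat" where
  "B n k = card {xs \<in> compositions n. Max (set xs) = k}"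

end

theory Submission
  imports Defs
begin

text \<open>
  Since \<open>k > n / 2\<close>, exactly one part of such a composition equals \<open>k\<close>. Splitting there
  identifies the compositions with pairs of possibly empty compositions of total
  \<open>m = n - k\<close>. As a positive integer \<open>i\<close> has \<open>2 ^ (i - 1)\<close> compositions, the two extreme
  splits contribute \<open>2 ^ (m - 1)\<close> each and the \<open>m - 1\<close> others \<open>2 ^ (m - 2)\<close> each.
\<close>

text \<open>Unlike \<open>compositions\<close>, this admits the empty list, since \<open>k\<close>
  may be the first or the last part.\<close>

definition positive_lists :: "nat \<Rightarrow> nat list set" where
  "positive_lists n = {xs. 0 \<notin> set xs \<and> sum_list xs = n}"

lemma positive_lists_0: "positive_lists 0 = {[]}"
proof -
  have "xs = []" if "0 \<notin> set xs" "sum_list xs = 0" for xs :: "nat list"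
    using that by (cases xs) auto
  then show ?thesis by (auto simp: positive_lists_def)
qed

text \<open>A leading 1 can be deleted and a larger leading part decreased by one; either way the
  total drops by one. The second move always leaves a nonempty list.\<close>

lemma positive_lists_Suc:
  "positive_lists (Suc n) =
     Cons 1 ` positive_lists n \<union> (\<lambda>xs. Suc (hd xs) # tl xs) ` (positive_lists n - {[]})"
  (is "?L = ?R")
proof
  show "?L \<subseteq> ?R"
  proof
    fix xs assume xs: "xs \<in> ?L"
    then obtain x ys where xs_eq: "xs = Suc x # ys"
      by (cases xs; cases "hd xs") (auto simp: positive_lists_def)
    show "xs \<in> ?R"
    proof (cases "x = 0")
      case True
      with xs xs_eq show ?thesis by (auto simp: positive_lists_def)
    next
      case False
      with xs xs_eq have "x # ys \<in> positive_lists n - {[]}"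
        by (auto simp: positive_lists_def)
      then have "Suc (hd (x # ys)) # tl (x # ys) \<in> ?R" by blast
      with xs_eq show ?thesis by simp
    qed
  qed
  show "?R \<subseteq> ?L"
  proof
    fix xs assume "xs \<in> ?R"
    then show "xs \<in> ?L"
    proof
      assume "xs \<in> Cons 1 ` positive_lists n"
      then show ?thesis by (auto simp: positive_lists_def)
    next
      assume "xs \<in> (\<lambda>xs. Suc (hd xs) # tl xs) ` (positive_lists n - {[]})"
      then obtain ys where "ys \<in> positive_lists n" "ys \<noteq> []" "xs = Suc (hd ys) # tl ys"
        by blast
      then show ?thesis by (cases ys) (auto simp: positive_lists_def)
    qed
  qed
qed

lemma finite_positive_lists: "finite (positive_lists n)"
  by (induction n) (simp_all add: positive_lists_0 positive_lists_Suc)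

text \<open>Both maps of the recursion are injective and their images differ in the head (1 or at
  least 2), so the count doubles. Doubling starts at total 1, where the empty list is no longer
  present.\<close>

lemma card_positive_lists_Suc: "card (positive_lists (Suc n)) = 2 ^ n"
proof (induction n)
  case 0
  show ?case by (simp add: positive_lists_Suc positive_lists_0)
next
  case (Suc n)
  let ?P = "positive_lists (Suc n)"
  let ?f = "\<lambda>xs :: nat list. Suc (hd xs) # tl xs"
  have P: "xs \<noteq> [] \<and> 0 < hd xs" if "xs \<in> ?P" for xs
    using that by (cases xs) (auto simp: positive_lists_def)
  then have ne: "?P - {[]} = ?P" by blast
  have inj: "inj_on ?f ?P"
    by (rule inj_onI) (use P in \<open>auto intro: list.expand\<close>)
  have disj: "Cons 1 ` ?P \<inter> ?f ` ?P = {}" using P by force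
  have "card (positive_lists (Suc (Suc n))) = card (Cons 1 ` ?P) + card (?f ` ?P)"
    unfolding positive_lists_Suc[of "Suc n"] ne
    by (rule card_Un_disjoint) (use disj finite_positive_lists in auto)
  also have "\<dots> = 2 ^ Suc n"
    using Suc by (simp add: card_image inj)
  finally show ?case .
qed

lemma Max_compositions_eq_image:
  assumes "m < k"
  shows "{xs \<in> compositions (m + k). Max (set xs) = k} =
    (\<lambda>(as, bs). as @ k # bs) ` (\<Union>i\<le>m. positive_lists i \<times> positive_lists (m - i))"
  (is "?L = ?R")
proof
  show "?L \<subseteq> ?R"
  proof
    fix xs assume "xs \<in> ?L"
    then have xs: "xs \<noteq> []" "0 \<notin> set xs" "sum_list xs = m + k" "Max (set xs) = k"
      by (auto simp: compositions_def)
    then have "k \<in> set xs" by (metis List.finite_set Max_in set_empty)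
    then obtain as bs where eq: "xs = as @ k # bs" by (meson split_list)
    with xs have "as \<in> positive_lists (sum_list as)" "bs \<in> positive_lists (m - sum_list as)"
      "sum_list as \<le> m"
      by (auto simp: positive_lists_def)
    with eq show "xs \<in> ?R" by (force intro!: image_eqI[of _ _ "(as, bs)"])
  qed
  show "?R \<subseteq> ?L"
  proof
    fix xs assume "xs \<in> ?R"
    then obtain i as bs where i: "i \<le> m" "as \<in> positive_lists i" "bs \<in> positive_lists (m - i)"
      and eq: "xs = as @ k # bs" by auto
    \<comment> \<open>An entry of \<open>as\<close> or \<open>bs\<close> is at most the sum of its
      list, hence at most \<open>m < k\<close>.\<close>
    have "x \<le> k" if "x \<in> set xs" for x
      using that i eq assms member_le_sum_list[of x as] member_le_sum_list[of x bs]
      by (auto simp: positive_lists_def)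
    then have "Max (set xs) = k" using eq by (intro Max_eqI) auto
    then show "xs \<in> ?L"
      using i eq assms by (auto simp: compositions_def positive_lists_def intro: gr0I)
  qed
qed

text \<open>The part \<open>k\<close> occurs only once, so its position determines \<open>as\<close>
  and \<open>bs\<close>; the index \<open>i\<close> is recovered as the sum of \<open>as\<close>,
  which makes the union disjoint.\<close>

lemma B_eq_convolution:
  assumes "m < k"
  shows "B (m + k) k = (\<Sum>i\<le>m. card (positive_lists i) * card (positive_lists (m - i)))"
proof -
  let ?S = "\<Union>i\<le>m. positive_lists i \<times> positive_lists (m - i)"
  have notin: "k \<notin> set as \<and> k \<notin> set bs" if "(as, bs) \<in> ?S" for as bs
    using that assms member_le_sum_list[of k as] member_le_sum_list[of k bs]
    by (auto simp: positive_lists_def)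
  have inj: "inj_on (\<lambda>(as, bs). as @ k # bs) ?S"
  proof (rule inj_onI, clarify)
    fix i as bs j cs ds
    assume "as \<in> positive_lists i" "bs \<in> positive_lists (m - i)" "i \<le> m"
      and eq: "as @ k # bs = cs @ k # ds"
    then have "k \<notin> set as \<and> k \<notin> set bs" by (intro notin) auto
    with eq show "as = cs \<and> bs = ds" by (simp add: append_Cons_eq_iff)
  qed
  have "B (m + k) k = card ?S"
    unfolding B_def Max_compositions_eq_image[OF assms] by (rule card_image[OF inj])
  also have "\<dots> = (\<Sum>i\<le>m. card (positive_lists i \<times> positive_lists (m - i)))"
    by (rule card_UN_disjoint) (auto simp: finite_positive_lists, auto simp: positive_lists_def)
  finally show ?thesis by (simp add: card_cartesian_product)
qed

text \<open>Here \<open>Suc m\<close> is the total outside the part \<open>k\<close>. Doubling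
  avoids the exponent \<open>m - 1\<close>, which would be truncated at
  \<open>m = 0\<close>.\<close>

lemma convolution_card_positive_lists:
  "2 * (\<Sum>i\<le>Suc m. card (positive_lists i) * card (positive_lists (Suc m - i))) = (m + 4) * 2 ^ m"
proof -
  let ?c = "\<lambda>i. card (positive_lists i)"
  \<comment> \<open>The terms \<open>i = 0\<close> and \<open>i = Suc m\<close> are split off, as
    the power formula holds only for positive totals.\<close>
  have "(\<Sum>i\<le>Suc m. ?c i * ?c (Suc m - i)) = 2 * 2 ^ m + (\<Sum>i<m. ?c (Suc i) * ?c (m - i))"
    unfolding sum.atMost_Suc sum.atMost_shift[of _ m]
    by (simp add: positive_lists_0 card_positive_lists_Suc)
  moreover have "2 * (?c (Suc i) * ?c (m - i)) = 2 ^ m" if "i < m" for i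
  proof -
    \<comment> \<open>Now \<open>m - i = Suc d\<close>, so the factors are \<open>2 ^ i\<close> and
      \<open>2 ^ d\<close> with \<open>i + d = m - 1\<close>.\<close>
    obtain d where "m = Suc (i + d)" using less_imp_Suc_add[OF \<open>i < m\<close>] by auto
    then show ?thesis by (simp add: Suc_diff_le card_positive_lists_Suc power_add)
  qed
  then have "2 * (\<Sum>i<m. ?c (Suc i) * ?c (m - i)) = m * 2 ^ m"
    by (simp add: sum_distrib_left)
  ultimately show ?thesis by (simp add: algebra_simps)
qed

theorem mainTheorem1:
  fixes n k :: nat
  assumes "0 < n" and "0 < k"
    and "real n / 2 < real k" and "k < n"
  shows "real (B n k) = (real n - real k + 3) * 2 powi (int n - int k - 2)"
proof -
  obtain m where n: "n = Suc m + k"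
    using less_imp_Suc_add[OF \<open>k < n\<close>] by auto
  with assms(3) have "Suc m < k" by linarith
  then have "2 * B n k = (m + 4) * 2 ^ m"
    by (simp only: n B_eq_convolution convolution_card_positive_lists)
  then have "2 * real (B n k) = (real m + 4) * 2 ^ m"
    by (metis of_nat_add of_nat_mult of_nat_numeral of_nat_power)
  then have "real (B n k) = (real n - real k + 3) * (2 ^ m / 2)"
    by (simp add: n add_ac)
  \<comment> \<open>The exponent equals \<open>m - 1\<close> over the integers; it is -1 when
    \<open>k = n - 1\<close>.\<close>
  also have "2 ^ m / 2 = (2::real) powi (int n - int k - 2)"
    using power_int_diff[of "2::real" "int m" 1] by (simp add: n)
  finally show ?thesis .
qed

end
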